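(* Suppose $f(1+x)=\sum_{k\ge1}c_kx^k$ is a power series with inverse $f^{-1}(x)=1+\sum_{k\ge1}b_kx^k$, where $b_1=1/c_1$. Let $\mathrm g$ be a grading on $\mathbb A^*$ preserved by the quasi-shuffle product, let $n\in\mathbb N$, and let $\pi_{\mathrm g\le n}$ be the projection according to $\mathrm g$. Let $$R=\mathrm{id}-F^{-1}\bigl(\pi_{\mathrm g\le n}\circ F^{\star}(\mathrm{id})\bigr),\qquad Q=F^{\star}(\mathrm{id})-\pi_{\mathrm g\le n}\circ F^{\star}(\mathrm{id})$$ be the remainder and pre-remainder, respectively, associated with the map-truncate-invert endomorphism $F^{-1}\circ\pi_{\mathrm g\le n}\circ F^{\star}(\mathrm{id})$. Then $$R=\frac1{c_1}Q+\mathrm{h.o.t.},$$ where $\mathrm{h.o.t.}$ denotes an endomorphism that annihilates every word $w$ with $\mathrm g(w)\le n+1$.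
   Context: $\mathbb A$ is an alphabet, $\mathbb A^*$ the set of words over $\mathbb A$ (with empty word $\mathbf 1$), $\mathbb R\langle\mathbb A\rangle$ the real vector space with basis $\mathbb A^*$. Given a commutative associative product $[\cdot,\cdot]$ on the span of the letters, the quasi-shuffle product $*$ on $\mathbb R\langle\mathbb A\rangle$ is the bilinear product with $u*\mathbf 1=\mathbf 1*u=u$ and $ua*vb=(u*vb)a+(ua*v)b+(u*v)[a,b]$ for words $u,v$ and letters $a,b$. The convolution product of linear endomorphisms $X,Y$ of $\mathbb R\langle\mathbb A\rangle$ is $(X\star Y)(w)=\sum_{uv=w}X(u)*Y(v)$, the sum being over all factorizations of the word $w$ by concatenation (including empty factors); its unit $\nu$ fixes $\mathbf 1$ and sends nonempty words to $0$. $\mathfrak J=\mathrm{id}-\nu$. A grading is a map $\mathrm g:\mathbb A^*\to\mathbb Z_{\ge0}$ that is positive on nonempty words and $0$ on $\mathbf 1$. It is preserved by $*$ if for all words $u,v$ the polynomial $u*v$ is a linear combination of words of grade $\mathrm g(u)+\mathrm g(v)$. $\pi_{\mathrm g\le n}$ is the linear projection fixing words of grade $\le n$ and sending all other words to $0$. For the power series above, $F^{\star}(\mathrm{id})=\sum_{k\ge1}c_k\mathfrak J^{\star k}$ (a finite sum on each word), and for an endomorphism $X$ with $X(\mathbf 1)=0$, $F^{-1}(X)=\nu+\sum_{k\ge1}b_kX^{\star k}$. *)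

theory Defs
  imports
    "HOL-Analysis.Finite_Function_Topology"
    "HOL-Analysis.Linear_Algebra"
    "HOL-Library.Groups_Big_Fun"
    "HOL-Computational_Algebra.Formal_Power_Series"
begin

text \<open>
  The alphabet is a type \<open>'a\<close>, words are lists, and the real vector space with
  basis \<open>'b\<close> is \<open>'b \<Rightarrow>\<^sub>0 real\<close>, the finitely supported functions.
\<close>

type_synonym 'a poly_words = "'a list \<Rightarrow>\<^sub>0 real"
type_synonym 'a letters_span = "'a \<Rightarrow>\<^sub>0 real"

abbreviation base :: "'b \<Rightarrow> ('b \<Rightarrow>\<^sub>0 real)"
  where "base x \<equiv> Poly_Mapping.single x 1"

definition lin_ext :: "('b \<Rightarrow> 'v::real_vector) \<Rightarrow> ('b \<Rightarrow>\<^sub>0 real) \<Rightarrow> 'v"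
  where "lin_ext f p = (\<Sum>x\<in>Poly_Mapping.keys p. Poly_Mapping.lookup p x *\<^sub>R f x)"

text \<open>The concatenation product \<open>P l\<close> of a polynomial and a combination of letters.\<close>

definition snoc_letters :: "'a poly_words \<Rightarrow> 'a letters_span \<Rightarrow> 'a poly_words"
  where "snoc_letters p l = lin_ext (\<lambda>u. lin_ext (\<lambda>a. base (u @ [a])) l) p"

text \<open>
  The recursion for the quasi-shuffle product peels off last letters, so it is run on
  reversed words; the defining equations on words are lemmas
  \<open>qshuffle_Nil\<close> and \<open>qshuffle_snoc\<close> below.
\<close>

fun qshuffle_rev ::
  "('a letters_span \<Rightarrow> 'a letters_span \<Rightarrow> 'a letters_span) \<Rightarrow> 'a list \<Rightarrow> 'a list \<Rightarrow> 'a poly_words"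
  where
    "qshuffle_rev br [] v = base (rev v)"
  | "qshuffle_rev br (a # u) [] = base (rev (a # u))"
  | "qshuffle_rev br (a # u) (b # v) =
       snoc_letters (qshuffle_rev br u (b # v)) (base a)
     + snoc_letters (qshuffle_rev br (a # u) v) (base b)
     + snoc_letters (qshuffle_rev br u v) (br (base a) (base b))"

definition qshuffle ::
  "('a letters_span \<Rightarrow> 'a letters_span \<Rightarrow> 'a letters_span) \<Rightarrow>
     'a poly_words \<Rightarrow> 'a poly_words \<Rightarrow> 'a poly_words"
  where "qshuffle br p q = lin_ext (\<lambda>u. lin_ext (\<lambda>v. qshuffle_rev br (rev u) (rev v)) q) p"

definition convolution ::
  "('a letters_span \<Rightarrow> 'a letters_span \<Rightarrow> 'a letters_span) \<Rightarrow>
     ('a poly_words \<Rightarrow> 'a poly_words) \<Rightarrow> ('a poly_words \<Rightarrow> 'a poly_words) \<Rightarrow>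
     'a poly_words \<Rightarrow> 'a poly_words"
  where "convolution br X Y =
    lin_ext (\<lambda>w. \<Sum>(u, v)\<in>{(u, v). u @ v = w}. qshuffle br (X (base u)) (Y (base v)))"

definition conv_unit :: "'a poly_words \<Rightarrow> 'a poly_words"
  where "conv_unit = lin_ext (\<lambda>w. if w = [] then base [] else 0)"

fun conv_power ::
  "('a letters_span \<Rightarrow> 'a letters_span \<Rightarrow> 'a letters_span) \<Rightarrow>
     ('a poly_words \<Rightarrow> 'a poly_words) \<Rightarrow> nat \<Rightarrow> 'a poly_words \<Rightarrow> 'a poly_words"
  where
    "conv_power br X 0 = conv_unit"
  | "conv_power br X (Suc k) = convolution br X (conv_power br X k)"

text \<open>
  \<open>\<Sum>k\<ge>0. A\<^sub>k X\<^sup>k\<close> with convolution powers. On each word this is a finite sum whenever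
  \<open>X\<close> kills the empty word (lemma \<open>conv_series_base\<close> below), the only case of interest.
\<close>

definition conv_series ::
  "('a letters_span \<Rightarrow> 'a letters_span \<Rightarrow> 'a letters_span) \<Rightarrow> real fps \<Rightarrow>
     ('a poly_words \<Rightarrow> 'a poly_words) \<Rightarrow> 'a poly_words \<Rightarrow> 'a poly_words"
  where "conv_series br A X =
    lin_ext (\<lambda>w. Sum_any (\<lambda>k. fps_nth A k *\<^sub>R conv_power br X k (base w)))"

definition aug :: "'a poly_words \<Rightarrow> 'a poly_words"
  where "aug p = p - conv_unit p"

text \<open>
  A power series \<open>f\<close> around \<open>1\<close> is given by the formal power series \<open>C\<close> of \<open>f(1+x)\<close>,
  and its inverse by the formal power series \<open>B\<close> of \<open>f\<^sup>-\<^sup>1(x)\<close>, with constant term \<open>1\<close>.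
  The two equations say \<open>f\<^sup>-\<^sup>1(f(1+x)) = 1+x\<close> and \<open>f(f\<^sup>-\<^sup>1(x)) = f(1+(f\<^sup>-\<^sup>1(x)-1)) = x\<close>.
\<close>

definition inverse_series_pair :: "real fps \<Rightarrow> real fps \<Rightarrow> bool"
  where "inverse_series_pair C B \<longleftrightarrow>
    fps_nth C 0 = 0 \<and> fps_nth B 0 = 1 \<and>
    fps_compose B C = 1 + fps_X \<and> fps_compose C (B - 1) = fps_X"

definition is_grading :: "('a list \<Rightarrow> nat) \<Rightarrow> bool"
  where "is_grading g \<longleftrightarrow> g [] = 0 \<and> (\<forall>w. w \<noteq> [] \<longrightarrow> g w > 0)"

definition grading_preserved ::
  "('a letters_span \<Rightarrow> 'a letters_span \<Rightarrow> 'a letters_span) \<Rightarrow> ('a list \<Rightarrow> nat) \<Rightarrow> bool"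
  where "grading_preserved br g \<longleftrightarrow>
    (\<forall>u v. qshuffle br (base u) (base v) \<in> span (base ` {w. g w = g u + g v}))"

definition trunc_proj :: "('a list \<Rightarrow> nat) \<Rightarrow> nat \<Rightarrow> 'a poly_words \<Rightarrow> 'a poly_words"
  where "trunc_proj g n = lin_ext (\<lambda>w. if g w \<le> n then base w else 0)"

definition mapped_id ::
  "('a letters_span \<Rightarrow> 'a letters_span \<Rightarrow> 'a letters_span) \<Rightarrow> real fps \<Rightarrow>
     'a poly_words \<Rightarrow> 'a poly_words"
  where "mapped_id br C = conv_series br C aug"

definition remainder ::
  "('a letters_span \<Rightarrow> 'a letters_span \<Rightarrow> 'a letters_span) \<Rightarrow> real fps \<Rightarrow> real fps \<Rightarrow>
     ('a list \<Rightarrow> nat) \<Rightarrow> nat \<Rightarrow> 'a poly_words \<Rightarrow> 'a poly_words"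
  where "remainder br C B g n p = p - conv_series br B (trunc_proj g n \<circ> mapped_id br C) p"

definition pre_remainder ::
  "('a letters_span \<Rightarrow> 'a letters_span \<Rightarrow> 'a letters_span) \<Rightarrow> real fps \<Rightarrow>
     ('a list \<Rightarrow> nat) \<Rightarrow> nat \<Rightarrow> 'a poly_words \<Rightarrow> 'a poly_words"
  where "pre_remainder br C g n p = mapped_id br C p - (trunc_proj g n \<circ> mapped_id br C) p"


lemma lin_ext_superset:
  assumes "finite S" "Poly_Mapping.keys p \<subseteq> S"
  shows "lin_ext f p = (\<Sum>x\<in>S. Poly_Mapping.lookup p x *\<^sub>R f x)"
  unfolding lin_ext_def using assms
  by (intro sum.mono_neutral_left) (auto simp: in_keys_iff)

lemma lin_ext_base [simp]: "lin_ext f (base x) = f x"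
  by (simp add: lin_ext_def)

lemma lookup_scaleR: "Poly_Mapping.lookup (c *\<^sub>R p) x = c *\<^sub>R Poly_Mapping.lookup p x"
proof -
  have "finite {x. c *\<^sub>R Poly_Mapping.lookup p x \<noteq> 0}"
    by (rule finite_subset[OF _ finite_keys[of p]]) (auto simp: in_keys_iff)
  then show ?thesis by (simp add: scaleR_poly_mapping_def)
qed

lemma linear_lin_ext: "linear (lin_ext f)"
proof (rule linearI)
  fix p q :: "'a \<Rightarrow>\<^sub>0 real" and c :: real
  let ?S = "Poly_Mapping.keys p \<union> Poly_Mapping.keys q"
  have "Poly_Mapping.keys (p + q) \<subseteq> ?S"
    by (rule Poly_Mapping.keys_add)
  then show "lin_ext f (p + q) = lin_ext f p + lin_ext f q"
    by (simp add: lin_ext_superset[of ?S] lookup_add scaleR_add_left sum.distrib)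
  have "Poly_Mapping.keys (c *\<^sub>R p) \<subseteq> Poly_Mapping.keys p"
    by (auto simp: in_keys_iff lookup_scaleR)
  then show "lin_ext f (c *\<^sub>R p) = c *\<^sub>R lin_ext f p"
    by (simp add: lin_ext_superset[of "Poly_Mapping.keys p"] lookup_scaleR scaleR_sum_right)
qed

lemma linear_qshuffle_right: "linear (qshuffle br p)"
proof -
  have "linear (\<lambda>q. \<Sum>x\<in>Poly_Mapping.keys p.
      Poly_Mapping.lookup p x *\<^sub>R lin_ext (\<lambda>v. qshuffle_rev br (rev x) (rev v)) q)"
    by (intro linear_compose_sum ballI linear_compose_scale_right linear_lin_ext)
  then show ?thesis by (simp add: qshuffle_def[abs_def] lin_ext_def[of _ p])
qed

lemma bilinear_qshuffle: "bilinear (qshuffle br)"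
  unfolding bilinear_def
proof (intro conjI allI)
  show "linear (\<lambda>q. qshuffle br p q)" for p
    by (rule linear_qshuffle_right)
  show "linear (\<lambda>p. qshuffle br p q)" for q
    unfolding qshuffle_def by (rule linear_lin_ext)
qed

lemma qshuffle_Nil:
  "qshuffle br (base u) (base []) = base u" "qshuffle br (base []) (base u) = base u"
  by (cases u rule: rev_cases; simp add: qshuffle_def)+

lemma qshuffle_snoc:
  "qshuffle br (base (u @ [a])) (base (v @ [b])) =
     snoc_letters (qshuffle br (base u) (base (v @ [b]))) (base a)
   + snoc_letters (qshuffle br (base (u @ [a])) (base v)) (base b)
   + snoc_letters (qshuffle br (base u) (base v)) (br (base a) (base b))"
  by (simp add: qshuffle_def)

lemma conv_power_eq_0:
  assumes "X (base []) = 0" "length w < k"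
  shows "conv_power br X k (base w) = 0"
  using assms(2)
proof (induction k arbitrary: w)
  case (Suc k)
  have "qshuffle br (X (base u)) (conv_power br X k (base v)) = 0" if "u @ v = w" for u v
  proof (cases "u = []")
    case True
    then show ?thesis
      using assms(1) bilinear_lzero[OF bilinear_qshuffle] by metis
  next
    case False
    then have "length v < length w"
      using that by auto
    then have "conv_power br X k (base v) = 0"
      using Suc by simp
    then show ?thesis
      using bilinear_rzero[OF bilinear_qshuffle] by metis
  qed
  then show ?case
    by (auto simp: convolution_def intro!: sum.neutral)
qed simp

lemma conv_series_base:
  assumes "X (base []) = 0"
  shows "conv_series br A X (base w) =
    (\<Sum>k\<le>length w. fps_nth A k *\<^sub>R conv_power br X k (base w))"
proof -
  have "{k. fps_nth A k *\<^sub>R conv_power br X k (base w) \<noteq> 0} \<subseteq> {..length w}"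
    using conv_power_eq_0[where X = X, OF assms] by (auto simp flip: not_less)
  then show ?thesis
    by (simp add: conv_series_def Sum_any.expand_superset)
qed

lemma inverse_series_pair_coeff_1:
  assumes "inverse_series_pair C B"
  shows "fps_nth C 1 \<noteq> 0" "fps_nth B 1 = 1 / fps_nth C 1"
proof -
  have "fps_nth (fps_compose B C) 1 = fps_nth (1 + fps_X) 1"
    using assms by (simp add: inverse_series_pair_def)
  then have "fps_nth B 1 * fps_nth C 1 = 1"
    using assms by (simp add: inverse_series_pair_def fps_compose_nth)
  then show "fps_nth C 1 \<noteq> 0" "fps_nth B 1 = 1 / fps_nth C 1"
    by (metis mult_zero_right zero_neq_one, metis eq_divide_eq mult_zero_right zero_neq_one)
qed

end

theory Submission
  imports Defs
begin

text \<open>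
  With \<open>F = F\<^sup>\<star>(id)\<close>, composing the series gives \<open>id = \<nu> + \<Sum>k. b\<^sub>k F\<^sup>\<star>\<^sup>k\<close>, so
  \<open>R = \<Sum>k. b\<^sub>k (F\<^sup>\<star>\<^sup>k - (\<pi> \<circ> F)\<^sup>\<star>\<^sup>k)\<close>, whose term for \<open>k = 1\<close> is \<open>Q / c\<^sub>1\<close>. Since \<open>uv\<close> occurs in
  \<open>u * v\<close> with a positive coefficient, a preserved grading is additive under concatenation. Hence
  a proper factor of a word \<open>w\<close> with \<open>g w \<le> n + 1\<close> has grade at most \<open>n\<close>; on such factors \<open>F\<close>,
  which preserves the grade, agrees with \<open>\<pi> \<circ> F\<close>, and the terms for \<open>k \<ge> 2\<close> vanish on \<open>w\<close>.
\<close>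

section \<open>Linear extension from a basis\<close>

lemma lookup_lin_ext:
  "Poly_Mapping.lookup (lin_ext f p) y =
     (\<Sum>x\<in>Poly_Mapping.keys p. Poly_Mapping.lookup p x * Poly_Mapping.lookup (f x) y)"
  by (simp add: lin_ext_def lookup_sum lookup_scaleR)

lemma lin_ext_base_id [simp]: "lin_ext base p = p"
  by (rule poly_mapping_eqI)
    (simp add: lookup_lin_ext lookup_single when_def if_distrib in_keys_iff cong: if_cong)

lemma linear_eq_lin_ext:
  assumes "linear f"
  shows "f = lin_ext (\<lambda>x. f (base x))"
proof
  fix p
  have "f p = f (lin_ext base p)"
    by simp
  also have "\<dots> = lin_ext (\<lambda>x. f (base x)) p"
    unfolding lin_ext_def by (simp add: linear_sum[OF assms] linear_scale[OF assms])
  finally show "f p = lin_ext (\<lambda>x. f (base x)) p" .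
qed

lemma linear_eqI_base:
  assumes "linear f" "linear h" "\<And>x. f (base x) = h (base x)"
  shows "f = h"
proof -
  have "f = lin_ext (\<lambda>x. f (base x))"
    by (rule linear_eq_lin_ext[OF assms(1)])
  also have "\<dots> = lin_ext (\<lambda>x. h (base x))"
    by (simp only: assms(3))
  also have "\<dots> = h"
    by (rule linear_eq_lin_ext[OF assms(2), symmetric])
  finally show ?thesis .
qed

lemma lin_ext_linear_right:
  assumes "\<And>x. linear (f x)"
  shows "linear (\<lambda>q. lin_ext (\<lambda>x. f x q) p)"
  unfolding lin_ext_def
  by (intro linear_compose_sum ballI linear_compose_scale_right assms)

lemma bilinear_lin_ext2: "bilinear (\<lambda>p q. lin_ext (\<lambda>u. lin_ext (f u) q) p)"
  unfolding bilinear_def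
  by (auto intro: linear_lin_ext lin_ext_linear_right)

section \<open>The quasi-shuffle product\<close>

lemma bilinear_snoc_letters: "bilinear snoc_letters"
  unfolding snoc_letters_def[abs_def] by (rule bilinear_lin_ext2)

lemma lookup_snoc_letters:
  "Poly_Mapping.lookup (snoc_letters p l) w =
     (if w = [] then 0 else Poly_Mapping.lookup p (butlast w) * Poly_Mapping.lookup l (last w))"
proof (cases w rule: rev_cases)
  case Nil
  then show ?thesis
    by (simp add: snoc_letters_def lookup_lin_ext lookup_single when_def)
next
  case (snoc w' c)
  have inner: "Poly_Mapping.lookup (lin_ext (\<lambda>a. base (u @ [a])) l) (w' @ [c]) =
      (if u = w' then Poly_Mapping.lookup l c else 0)" for u
    by (simp add: lookup_lin_ext lookup_single when_def if_distrib in_keys_iff cong: if_cong)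
  show ?thesis
    by (simp add: snoc_letters_def lookup_lin_ext[of _ p] inner snoc if_distrib in_keys_iff cong: if_cong)
qed

lemmas qshuffle_linear =
  bilinear_ladd[OF bilinear_qshuffle] bilinear_radd[OF bilinear_qshuffle]
  bilinear_lmul[OF bilinear_qshuffle] bilinear_rmul[OF bilinear_qshuffle]

lemmas snoc_letters_linear =
  bilinear_ladd[OF bilinear_snoc_letters] bilinear_radd[OF bilinear_snoc_letters]
  bilinear_lmul[OF bilinear_snoc_letters] bilinear_rmul[OF bilinear_snoc_letters]

lemmas qshuffle_zero [simp] =
  bilinear_lzero[OF bilinear_qshuffle] bilinear_rzero[OF bilinear_qshuffle]

lemma qshuffle_sum:
  "qshuffle br (\<Sum>i\<in>S. x i) q = (\<Sum>i\<in>S. qshuffle br (x i) q)"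
  "qshuffle br q (\<Sum>i\<in>S. x i) = (\<Sum>i\<in>S. qshuffle br q (x i))"
  using bilinear_qshuffle[of br] unfolding bilinear_def by (auto intro: linear_sum)

lemma qshuffle_one [simp]: "qshuffle br p (base []) = p" "qshuffle br (base []) p = p"
proof -
  have "(\<lambda>p. qshuffle br p (base [])) = id" "(\<lambda>p. qshuffle br (base []) p) = id"
    by (rule linear_eqI_base; simp add: linearI qshuffle_linear qshuffle_Nil linear_id)+
  then show "qshuffle br p (base []) = p" "qshuffle br (base []) p = p"
    by (metis id_apply)+
qed

lemma qshuffle_snoc_letters:
  assumes br: "bilinear br"
  shows "qshuffle br (snoc_letters p l) (snoc_letters q m) =
     snoc_letters (qshuffle br p (snoc_letters q m)) l
   + snoc_letters (qshuffle br (snoc_letters p l) q) m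
   + snoc_letters (qshuffle br p q) (br l m)"
proof -
  note lin = qshuffle_linear snoc_letters_linear bilinear_ladd[OF br] bilinear_radd[OF br]
    bilinear_lmul[OF br] bilinear_rmul[OF br] scaleR_add_right
  have base_snoc: "snoc_letters (base u) (base a) = base (u @ [a])" for u :: "'a list" and a
    by (simp add: snoc_letters_def)
  have 1: "qshuffle br (snoc_letters (base u) (base a)) (snoc_letters (base v) (base b)) =
     snoc_letters (qshuffle br (base u) (snoc_letters (base v) (base b))) (base a)
   + snoc_letters (qshuffle br (snoc_letters (base u) (base a)) (base v)) (base b)
   + snoc_letters (qshuffle br (base u) (base v)) (br (base a) (base b))" for u a v b
    by (simp add: base_snoc qshuffle_snoc)
  have 2: "qshuffle br (snoc_letters (base u) (base a)) (snoc_letters (base v) m) =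
     snoc_letters (qshuffle br (base u) (snoc_letters (base v) m)) (base a)
   + snoc_letters (qshuffle br (snoc_letters (base u) (base a)) (base v)) m
   + snoc_letters (qshuffle br (base u) (base v)) (br (base a) m)" for u a v m
    by (rule fun_cong[where x = m], rule linear_eqI_base)
      (simp_all add: 1 linearI lin)
  have 3: "qshuffle br (snoc_letters (base u) (base a)) (snoc_letters q m) =
     snoc_letters (qshuffle br (base u) (snoc_letters q m)) (base a)
   + snoc_letters (qshuffle br (snoc_letters (base u) (base a)) q) m
   + snoc_letters (qshuffle br (base u) q) (br (base a) m)" for u a q m
    by (rule fun_cong[where x = q], rule linear_eqI_base)
      (simp_all add: 2 linearI lin)
  have 4: "qshuffle br (snoc_letters (base u) l) (snoc_letters q m) =
     snoc_letters (qshuffle br (base u) (snoc_letters q m)) l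
   + snoc_letters (qshuffle br (snoc_letters (base u) l) q) m
   + snoc_letters (qshuffle br (base u) q) (br l m)" for u l q m
    by (rule fun_cong[where x = l], rule linear_eqI_base)
      (simp_all add: 3 linearI lin)
  show ?thesis
    by (rule fun_cong[where x = p], rule linear_eqI_base)
      (simp_all add: 4 linearI lin)
qed

lemma qshuffle_assoc_base:
  assumes br: "bilinear br" and assoc: "\<And>x y z. br (br x y) z = br x (br y z)"
  shows "qshuffle br (qshuffle br (base x) (base y)) (base z) =
    qshuffle br (base x) (qshuffle br (base y) (base z))"
proof (induction "length x + length y + length z" arbitrary: x y z rule: less_induct)
  case less
  show ?case
  proof (cases "x = [] \<or> y = [] \<or> z = []")
    case True
    then show ?thesis by auto
  next
    case False
    then obtain u a v b w c where xyz: "x = u @ [a]" "y = v @ [b]" "z = w @ [c]"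
      by (metis rev_exhaust)
    let ?m = "qshuffle br" and ?s = "snoc_letters"
    have s: "base x = ?s (base u) (base a)" "base y = ?s (base v) (base b)"
      "base z = ?s (base w) (base c)"
      by (simp_all add: xyz snoc_letters_def)
    note expand = qshuffle_snoc_letters[OF br]
    have xy: "?m (base x) (base y) = ?s (?m (base u) (base y)) (base a)
        + ?s (?m (base x) (base v)) (base b) + ?s (?m (base u) (base v)) (br (base a) (base b))"
      unfolding s by (rule expand)
    have yz: "?m (base y) (base z) = ?s (?m (base v) (base z)) (base b)
        + ?s (?m (base y) (base w)) (base c) + ?s (?m (base v) (base w)) (br (base b) (base c))"
      unfolding s by (rule expand)
    have left: "?m (?s p l) (base z) = ?s (?m p (base z)) l
        + ?s (?m (?s p l) (base w)) (base c) + ?s (?m p (base w)) (br l (base c))" for p l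
      unfolding s by (rule expand)
    have right: "?m (base x) (?s p l) = ?s (?m (base u) (?s p l)) (base a)
        + ?s (?m (base x) p) l + ?s (?m (base u) p) (br (base a) l)" for p l
      unfolding s by (rule expand)
    have "?m (?m (base x) (base y)) (base z) =
        ?s (?m (?m (base u) (base y)) (base z)) (base a)
      + ?s (?m (?m (base x) (base v)) (base z)) (base b)
      + ?s (?m (?m (base x) (base y)) (base w)) (base c)
      + ?s (?m (?m (base u) (base y)) (base w)) (br (base a) (base c))
      + ?s (?m (?m (base x) (base v)) (base w)) (br (base b) (base c))
      + ?s (?m (?m (base u) (base v)) (base z)) (br (base a) (base b))
      + ?s (?m (?m (base u) (base v)) (base w)) (br (br (base a) (base b)) (base c))"
      unfolding xy by (simp only: left qshuffle_linear snoc_letters_linear ac_simps)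
    also have "\<dots> =
        ?s (?m (base u) (?m (base y) (base z))) (base a)
      + ?s (?m (base x) (?m (base v) (base z))) (base b)
      + ?s (?m (base x) (?m (base y) (base w))) (base c)
      + ?s (?m (base u) (?m (base y) (base w))) (br (base a) (base c))
      + ?s (?m (base x) (?m (base v) (base w))) (br (base b) (base c))
      + ?s (?m (base u) (?m (base v) (base z))) (br (base a) (base b))
      + ?s (?m (base u) (?m (base v) (base w))) (br (base a) (br (base b) (base c)))"
      by (simp add: less xyz assoc)
    also have "\<dots> = ?m (base x) (?m (base y) (base z))"
      unfolding yz by (simp only: right qshuffle_linear snoc_letters_linear ac_simps)
    finally show ?thesis .
  qed
qed

lemma qshuffle_assoc:
  assumes "bilinear br" "\<And>x y z. br (br x y) z = br x (br y z)"
  shows "qshuffle br (qshuffle br p q) r = qshuffle br p (qshuffle br q r)"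
proof -
  note lin = linearI qshuffle_linear
  have 1: "qshuffle br (qshuffle br (base x) (base y)) r =
      qshuffle br (base x) (qshuffle br (base y) r)" for x y r
    by (rule fun_cong[where x = r], rule linear_eqI_base)
      (simp_all add: qshuffle_assoc_base[where br = br, OF assms] lin)
  have 2: "qshuffle br (qshuffle br (base x) q) r =
      qshuffle br (base x) (qshuffle br q r)" for x q r
    by (rule fun_cong[where x = q], rule linear_eqI_base) (simp_all add: 1 lin)
  show ?thesis
    by (rule fun_cong[where x = p], rule linear_eqI_base) (simp_all add: 2 lin)
qed

text \<open>The bracket terms only produce words shorter than \<open>u @ v\<close>, whatever the signs of \<open>br\<close>.\<close>

lemma lookup_qshuffle_long:
  "(length w > length u + length v \<longrightarrow> Poly_Mapping.lookup (qshuffle br (base u) (base v)) w = 0) \<and>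
   (length w = length u + length v \<longrightarrow> Poly_Mapping.lookup (qshuffle br (base u) (base v)) w \<ge> 0) \<and>
   (w = u @ v \<longrightarrow> Poly_Mapping.lookup (qshuffle br (base u) (base v)) w > 0)"
proof (induction "length u + length v" arbitrary: u v w rule: less_induct)
  case less
  show ?case
  proof (cases "u = [] \<or> v = []")
    case True
    then show ?thesis
      by (auto simp: lookup_single when_def)
  next
    case False
    then obtain u' a v' b where uv: "u = u' @ [a]" "v = v' @ [b]"
      by (metis rev_exhaust)
    let ?m = "\<lambda>x y. Poly_Mapping.lookup (qshuffle br (base x) (base y)) (butlast w)"
    have eq: "Poly_Mapping.lookup (qshuffle br (base u) (base v)) w =
      (if w = [] then 0 else ?m u' v * (if last w = a then 1 else 0)
        + ?m u v' * (if last w = b then 1 else 0)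
        + ?m u' v' * Poly_Mapping.lookup (br (base a) (base b)) (last w))"
      unfolding uv qshuffle_snoc
      by (simp add: lookup_add lookup_snoc_letters lookup_single when_def)
    note IH = less[of u' v "butlast w"] less[of u v' "butlast w"] less[of u' v' "butlast w"]
    show ?thesis
    proof (intro conjI impI)
      assume "length w > length u + length v"
      then show "Poly_Mapping.lookup (qshuffle br (base u) (base v)) w = 0"
        using IH unfolding eq by (auto simp: uv)
    next
      assume "length w = length u + length v"
      then show "Poly_Mapping.lookup (qshuffle br (base u) (base v)) w \<ge> 0"
        using IH unfolding eq by (auto simp: uv)
    next
      assume w: "w = u @ v"
      then have "?m u v' > 0" "?m u' v \<ge> 0" "?m u' v' = 0" "last w = b" "w \<noteq> []"
        using IH by (auto simp: uv butlast_append)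
      then show "Poly_Mapping.lookup (qshuffle br (base u) (base v)) w > 0"
        unfolding eq by (auto simp: add_nonneg_pos)
    qed
  qed
qed

section \<open>The convolution algebra\<close>

lemma finite_splits: "finite {(u, v). u @ v = w}"
proof -
  have "{(u, v). u @ v = w} \<subseteq> (\<lambda>i. (take i w, drop i w)) ` {..length w}"
  proof clarify
    fix u v
    show "(u, v) \<in> (\<lambda>i. (take i (u @ v), drop i (u @ v))) ` {..length (u @ v)}"
      by (intro image_eqI[of _ _ "length u"]) auto
  qed
  then show ?thesis
    by (rule finite_subset) simp
qed

lemma convolution_base:
  "convolution br X Y (base w) =
    (\<Sum>(u, v)\<in>{(u, v). u @ v = w}. qshuffle br (X (base u)) (Y (base v)))"
  by (simp add: convolution_def)

lemma convolution_cong: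
  assumes "\<And>u v. u @ v = w \<Longrightarrow>
    qshuffle br (X (base u)) (Y (base v)) = qshuffle br (X' (base u)) (Y' (base v))"
  shows "convolution br X Y (base w) = convolution br X' Y' (base w)"
  unfolding convolution_base using assms by (auto intro: sum.cong)

lemma linear_conv_power: "linear (conv_power br X k)"
  by (cases k) (simp_all add: conv_unit_def convolution_def linear_lin_ext)

lemma convolution_unit_left:
  assumes "linear X"
  shows "convolution br conv_unit X = X"
proof (rule linear_eqI_base)
  fix w
  have "convolution br conv_unit X (base w) =
    (\<Sum>(u, v)\<in>{([], w)}. qshuffle br (conv_unit (base u)) (X (base v)))"
    unfolding convolution_base
    by (rule sum.mono_neutral_right[OF finite_splits]) (auto simp: conv_unit_def split: if_splits)
  then show "convolution br conv_unit X (base w) = X (base w)"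
    by (simp add: conv_unit_def)
qed (simp_all add: assms convolution_def linear_lin_ext)

lemma convolution_unit_right:
  assumes "linear X"
  shows "convolution br X conv_unit = X"
proof (rule linear_eqI_base)
  fix w
  have "convolution br X conv_unit (base w) =
    (\<Sum>(u, v)\<in>{(w, [])}. qshuffle br (X (base u)) (conv_unit (base v)))"
    unfolding convolution_base
    by (rule sum.mono_neutral_right[OF finite_splits]) (auto simp: conv_unit_def split: if_splits)
  then show "convolution br X conv_unit (base w) = X (base w)"
    by (simp add: conv_unit_def)
qed (simp_all add: assms convolution_def linear_lin_ext)

lemma convolution_assoc:
  assumes "bilinear br" "\<And>x y z. br (br x y) z = br x (br y z)"
  shows "convolution br (convolution br X Y) Z = convolution br X (convolution br Y Z)"
proof (rule linear_eqI_base)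
  fix w
  let ?m = "qshuffle br"
  let ?S = "\<lambda>w. {(u, v). u @ v = (w :: 'a list)}"
  have "convolution br (convolution br X Y) Z (base w) =
      (\<Sum>s\<in>?S w. \<Sum>t\<in>?S (fst s).
        ?m (?m (X (base (fst t))) (Y (base (snd t)))) (Z (base (snd s))))"
    by (simp add: convolution_base qshuffle_sum case_prod_unfold)
  also have "\<dots> = (\<Sum>(s, t)\<in>Sigma (?S w) (\<lambda>s. ?S (fst s)).
        ?m (?m (X (base (fst t))) (Y (base (snd t)))) (Z (base (snd s))))"
    by (rule sum.Sigma) (auto simp: finite_splits)
  also have "\<dots> = (\<Sum>(s, t)\<in>Sigma (?S w) (\<lambda>s. ?S (snd s)).
        ?m (X (base (fst s))) (?m (Y (base (fst t))) (Z (base (snd t)))))"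
    by (rule sum.reindex_bij_witness[where
        i = "\<lambda>((x, _), (y, z)). ((x @ y, z), (x, y))" and
        j = "\<lambda>((_, z), (x, y)). ((x, y @ z), (y, z))"])
      (auto simp: qshuffle_assoc[where br = br, OF assms])
  also have "\<dots> = (\<Sum>s\<in>?S w. \<Sum>t\<in>?S (snd s).
        ?m (X (base (fst s))) (?m (Y (base (fst t))) (Z (base (snd t)))))"
    by (rule sum.Sigma[symmetric]) (auto simp: finite_splits)
  also have "\<dots> = convolution br X (convolution br Y Z) (base w)"
    by (simp add: convolution_base qshuffle_sum case_prod_unfold)
  finally show "convolution br (convolution br X Y) Z (base w) =
      convolution br X (convolution br Y Z) (base w)" .
qed (simp_all add: convolution_def linear_lin_ext)

lemma conv_power_add:
  assumes "bilinear br" "\<And>x y z. br (br x y) z = br x (br y z)"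
  shows "conv_power br X (i + j) = convolution br (conv_power br X i) (conv_power br X j)"
  by (induction i) (simp_all add: convolution_unit_left linear_conv_power convolution_assoc[where br = br, OF assms])

lemma conv_series_base_ge:
  assumes "X (base []) = 0" "length w \<le> N"
  shows "conv_series br A X (base w) = (\<Sum>k\<le>N. fps_nth A k *\<^sub>R conv_power br X k (base w))"
  unfolding conv_series_base[where X = X, OF assms(1)] using assms
  by (intro sum.mono_neutral_left) (auto simp: conv_power_eq_0)

lemma linear_conv_series: "linear (conv_series br A X)"
  by (simp add: conv_series_def linear_lin_ext)

lemma conv_series_mult:
  fixes br :: "'a letters_span \<Rightarrow> 'a letters_span \<Rightarrow> 'a letters_span"
  assumes br: "bilinear br" "\<And>x y z. br (br x y) z = br x (br y z)"
    and X: "X (base []) = 0"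
  shows "conv_series br (A * A') X = convolution br (conv_series br A X) (conv_series br A' X)"
proof (rule linear_eqI_base)
  fix w :: "'a list"
  define N where "N = length w"
  define S where "S = {(u, v). u @ v = w}"
  let ?P = "\<lambda>k. conv_power br X k" and ?m = "qshuffle br"
  let ?f = "\<lambda>i j. (fps_nth A i * fps_nth A' j) *\<^sub>R ?P (i + j) (base w)"
  have conv: "convolution br Y Z (base w) = (\<Sum>s\<in>S. ?m (Y (base (fst s))) (Z (base (snd s))))" for Y Z
    by (simp add: convolution_base S_def case_prod_unfold)
  have "convolution br (conv_series br A X) (conv_series br A' X) (base w) =
      (\<Sum>s\<in>S. \<Sum>i\<le>N. \<Sum>j\<le>N. (fps_nth A i * fps_nth A' j) *\<^sub>R
        ?m (?P i (base (fst s))) (?P j (base (snd s))))"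
    unfolding conv
  proof (rule sum.cong[OF refl])
    fix s assume "s \<in> S"
    then have "length (fst s) \<le> N" "length (snd s) \<le> N"
      by (auto simp: N_def S_def)
    then show "?m (conv_series br A X (base (fst s))) (conv_series br A' X (base (snd s))) =
        (\<Sum>i\<le>N. \<Sum>j\<le>N. (fps_nth A i * fps_nth A' j) *\<^sub>R
          ?m (?P i (base (fst s))) (?P j (base (snd s))))"
      unfolding conv_series_base_ge[where X = X, OF X \<open>length (fst s) \<le> N\<close>]
        conv_series_base_ge[where X = X, OF X \<open>length (snd s) \<le> N\<close>] qshuffle_sum(1)
      by (simp add: qshuffle_sum(2) qshuffle_linear scaleR_sum_right mult.commute)
  qed
  also have "\<dots> = (\<Sum>i\<le>N. \<Sum>s\<in>S. \<Sum>j\<le>N. (fps_nth A i * fps_nth A' j) *\<^sub>R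
        ?m (?P i (base (fst s))) (?P j (base (snd s))))"
    by (rule sum.swap)
  also have "\<dots> = (\<Sum>i\<le>N. \<Sum>j\<le>N. \<Sum>s\<in>S. (fps_nth A i * fps_nth A' j) *\<^sub>R
        ?m (?P i (base (fst s))) (?P j (base (snd s))))"
    by (intro sum.cong[OF refl] sum.swap)
  also have "\<dots> = (\<Sum>i\<le>N. \<Sum>j\<le>N. ?f i j)"
    by (simp add: conv_power_add[where br = br, OF br] conv scaleR_sum_right)
  also have "\<dots> = (\<Sum>(i, j)\<in>{..N} \<times> {..N}. ?f i j)"
    by (simp add: sum.cartesian_product)
  also have "\<dots> = (\<Sum>(i, j)\<in>{(i, j). i + j \<le> N}. ?f i j)"
  proof (rule sum.mono_neutral_right)
    have "?P k (base w) = 0" if "\<not> k \<le> N" for k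
      using that by (simp add: N_def conv_power_eq_0[where X = X, OF X])
    then show "\<forall>s\<in>{..N} \<times> {..N} - {(i, j). i + j \<le> N}. (case s of (i, j) \<Rightarrow> ?f i j) = 0"
      by force
  qed auto
  also have "\<dots> = (\<Sum>k\<le>N. \<Sum>i\<le>k. ?f i (k - i))"
    by (rule sum.triangle_reindex_eq)
  also have "\<dots> = conv_series br (A * A') X (base w)"
    by (simp add: conv_series_base[where X = X, OF X] N_def fps_mult_nth scaleR_sum_left atLeast0AtMost)
  finally show "conv_series br (A * A') X (base w) =
      convolution br (conv_series br A X) (conv_series br A' X) (base w)" ..
qed (simp_all add: linear_conv_series convolution_def linear_lin_ext)

lemma conv_series_one:
  assumes "X (base []) = 0"
  shows "conv_series br 1 X = conv_unit"
proof (rule linear_eqI_base)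
  show "conv_series br 1 X (base w) = conv_unit (base w)" for w
    by (simp add: conv_series_base[where X = X, OF assms] if_distrib[of "\<lambda>c. c *\<^sub>R _"] cong: if_cong)
qed (simp_all add: linear_conv_series conv_unit_def linear_lin_ext)

lemma conv_series_power:
  assumes "bilinear br" "\<And>x y z. br (br x y) z = br x (br y z)" "X (base []) = 0"
  shows "conv_power br (conv_series br A X) k = conv_series br (A ^ k) X"
  by (induction k)
    (simp_all add: conv_series_one[where X = X, OF assms(3)] conv_series_mult[where X = X, OF assms])

lemma conv_series_Nil:
  assumes "X (base []) = 0"
  shows "conv_series br A X (base []) = fps_nth A 0 *\<^sub>R base []"
  by (simp add: conv_series_base[where X = X, OF assms] conv_unit_def)

lemma conv_series_compose:
  fixes br :: "'a letters_span \<Rightarrow> 'a letters_span \<Rightarrow> 'a letters_span"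
  assumes br: "bilinear br" "\<And>x y z. br (br x y) z = br x (br y z)"
    and X: "X (base []) = 0" and C: "fps_nth C 0 = 0"
  shows "conv_series br B (conv_series br C X) = conv_series br (fps_compose B C) X"
proof (rule linear_eqI_base)
  fix w :: "'a list"
  define N where "N = length w"
  have C0: "conv_series br C X (base []) = 0"
    by (simp add: conv_series_Nil[where X = X, OF X] C)
  have nth: "fps_nth (fps_compose B C) j = (\<Sum>k\<le>N. fps_nth B k * fps_nth (C ^ k) j)"
    if "j \<le> N" for j
    unfolding fps_compose_nth using that C
    by (intro sum.mono_neutral_left) (auto simp: startsby_zero_power_prefix)
  have "conv_series br B (conv_series br C X) (base w) =
      (\<Sum>k\<le>N. \<Sum>j\<le>N. (fps_nth B k * fps_nth (C ^ k) j) *\<^sub>R conv_power br X j (base w))"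
    by (simp add: conv_series_base[where X = "conv_series br C X", OF C0]
        conv_series_power[where X = X, OF br X] conv_series_base[where X = X, OF X]
        N_def scaleR_sum_right)
  also have "\<dots> = (\<Sum>j\<le>N. fps_nth (fps_compose B C) j *\<^sub>R conv_power br X j (base w))"
    by (subst sum.swap) (simp add: nth scaleR_sum_left)
  also have "\<dots> = conv_series br (fps_compose B C) X (base w)"
    by (simp add: conv_series_base[where X = X, OF X] N_def)
  finally show "conv_series br B (conv_series br C X) (base w) =
      conv_series br (fps_compose B C) X (base w)" .
qed (simp_all add: linear_conv_series)

lemma aug_Nil [simp]: "aug (base []) = 0"
  by (simp add: aug_def conv_unit_def)

lemma linear_aug: "linear aug"
  unfolding aug_def[abs_def] conv_unit_def
  by (intro linear_compose_sub linear_lin_ext linear_ident)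

lemma conv_series_one_plus_X:
  "conv_series br (1 + fps_X) aug = id"
proof (rule linear_eqI_base)
  fix w
  have "conv_series br (1 + fps_X) aug (base w) =
      (\<Sum>k\<le>Suc (length w). fps_nth (1 + fps_X) k *\<^sub>R conv_power br aug k (base w))"
    by (rule conv_series_base_ge) simp_all
  also have "\<dots> = (\<Sum>k\<in>{0, 1}. fps_nth (1 + fps_X) k *\<^sub>R conv_power br aug k (base w))"
    by (rule sum.mono_neutral_right) auto
  also have "\<dots> = conv_unit (base w) + aug (base w)"
    by (simp add: convolution_unit_right linear_aug)
  finally show "conv_series br (1 + fps_X) aug (base w) = id (base w)"
    by (simp add: aug_def)
qed (simp_all add: linear_conv_series linear_id)

lemma conv_series_mapped_id:
  assumes "bilinear br" "\<And>x y z. br (br x y) z = br x (br y z)" "inverse_series_pair C B"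
  shows "conv_series br B (mapped_id br C) = id"
  using assms
  by (simp add: mapped_id_def conv_series_compose inverse_series_pair_def conv_series_one_plus_X)

section \<open>Gradings and truncation\<close>

lemma grade_append:
  assumes "grading_preserved br g"
  shows "g (u @ v) = g u + g v"
proof -
  have "Poly_Mapping.lookup p w = 0"
    if "p \<in> span (base ` {w. g w = m})" "g w \<noteq> m" for p m w
    using that
    by (induction rule: span_induct_alt) (auto simp: lookup_add lookup_scaleR lookup_single when_def split: if_splits)
  moreover have "Poly_Mapping.lookup (qshuffle br (base u) (base v)) (u @ v) > 0"
    using lookup_qshuffle_long by blast
  ultimately show ?thesis
    using assms unfolding grading_preserved_def by (metis less_irrefl)
qed

lemma qshuffle_graded:
  assumes "grading_preserved br g"
    and "p \<in> span (base ` {w. g w = i})" "q \<in> span (base ` {w. g w = j})"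
  shows "qshuffle br p q \<in> span (base ` {w. g w = i + j})"
proof -
  have 1: "qshuffle br (base u) q \<in> span (base ` {w. g w = i + j})" if "g u = i" for u
    using assms(3)
  proof (induction rule: span_induct_alt)
    case (step c x y)
    then obtain v where "x = base v" "g v = j" by auto
    then have "qshuffle br (base u) x \<in> span (base ` {w. g w = i + j})"
      using assms(1) that by (auto simp: grading_preserved_def)
    then show ?case
      using step by (simp add: qshuffle_linear span_add span_scale)
  qed (simp add: span_zero)
  show ?thesis
    using assms(2)
  proof (induction rule: span_induct_alt)
    case (step c x y)
    then have "qshuffle br x q \<in> span (base ` {w. g w = i + j})"
      using 1 by blast
    then show ?case
      using step by (simp add: qshuffle_linear span_add span_scale)
  qed (simp add: span_zero)
qed

lemma conv_power_graded:
  assumes g: "is_grading g" "grading_preserved br g"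
    and X: "\<And>w. X (base w) \<in> span (base ` {v. g v = g w})"
  shows "conv_power br X k (base w) \<in> span (base ` {v. g v = g w})"
proof (induction k arbitrary: w)
  case 0
  show ?case
    by (auto simp: conv_unit_def span_zero intro: span_base)
next
  case (Suc k)
  have "qshuffle br (X (base u)) (conv_power br X k (base v)) \<in> span (base ` {v. g v = g w})"
    if "u @ v = w" for u v
    using qshuffle_graded[OF g(2) X Suc] that grade_append[OF g(2)] by metis
  then show ?case
    by (auto simp: convolution_base intro!: span_sum)
qed

lemma mapped_id_graded:
  assumes "is_grading g" "grading_preserved br g"
  shows "mapped_id br C (base w) \<in> span (base ` {v. g v = g w})"
proof -
  have "aug (base u) \<in> span (base ` {v. g v = g u})" for u
    by (auto simp: aug_def conv_unit_def span_zero intro: span_base)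
  then show ?thesis
    unfolding mapped_id_def conv_series_base[where X = aug, OF aug_Nil]
    by (intro span_sum span_scale conv_power_graded[OF assms])
qed

lemma linear_trunc_proj: "linear (trunc_proj g n)"
  by (simp add: trunc_proj_def linear_lin_ext)

lemma trunc_proj_graded:
  assumes "p \<in> span (base ` {w. g w = m})" "m \<le> n"
  shows "trunc_proj g n p = p"
  using assms(1)
proof (induction rule: span_induct_alt)
  case base
  show ?case by (rule linear_0[OF linear_trunc_proj])
next
  case (step c x y)
  then show ?case
    using assms(2)
    by (auto simp: linear_add[OF linear_trunc_proj] linear_scale[OF linear_trunc_proj])
      (simp add: trunc_proj_def)
qed

lemma conv_power_cong_graded:
  assumes "grading_preserved br g" "\<And>u. g u \<le> n \<Longrightarrow> X (base u) = Y (base u)" "g w \<le> n"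
  shows "conv_power br X k (base w) = conv_power br Y k (base w)"
  using assms(3)
proof (induction k arbitrary: w)
  case (Suc k)
  then show ?case
    by (auto intro!: convolution_cong simp: assms grade_append[OF assms(1)])
qed simp

lemma conv_power_cong_next_grade:
  assumes g: "is_grading g" "grading_preserved br g"
    and XY: "\<And>u. g u \<le> n \<Longrightarrow> X (base u) = Y (base u)"
    and X0: "X (base []) = 0"
    and w: "g w \<le> n + 1" and k: "k \<ge> 2"
  shows "conv_power br X k (base w) = conv_power br Y k (base w)"
proof -
  obtain j where j: "k = Suc j" "j > 0"
    using k by (cases k) auto
  have Y0: "Y (base []) = 0"
    using XY[of "[]"] X0 g(1) by (simp add: is_grading_def)
  have "qshuffle br (X (base u)) (conv_power br X j (base v)) =
      qshuffle br (Y (base u)) (conv_power br Y j (base v))" if "u @ v = w" for u v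
  proof (cases "u = [] \<or> v = []")
    case True
    then show ?thesis
      using j(2) by (auto simp: X0 Y0 conv_power_eq_0)
  next
    case False
    then have "g u > 0" "g v > 0"
      using g(1) by (auto simp: is_grading_def)
    then have "g u \<le> n" "g v \<le> n"
      using w that grade_append[OF g(2), of u v] by auto
    then show ?thesis
      using XY conv_power_cong_graded[where X = X and Y = Y, OF g(2) XY] by metis
  qed
  then show ?thesis
    by (auto simp: j(1) intro: convolution_cong)
qed

theorem lemma2:
  fixes br :: "('a \<Rightarrow>\<^sub>0 real) \<Rightarrow> ('a \<Rightarrow>\<^sub>0 real) \<Rightarrow> ('a \<Rightarrow>\<^sub>0 real)"
    and C B :: "real fps"
    and g :: "'a list \<Rightarrow> nat"
    and n :: nat
  assumes "bilinear br"
    and "\<And>x y. br x y = br y x"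
    and "\<And>x y z. br (br x y) z = br x (br y z)"
    and "inverse_series_pair C B"
    and "is_grading g"
    and "grading_preserved br g"
  shows "\<exists>h. linear h \<and> (\<forall>w. g w \<le> n + 1 \<longrightarrow> h (base w) = 0) \<and>
    (\<forall>p. remainder br C B g n p = (1 / fps_nth C 1) *\<^sub>R pre_remainder br C g n p + h p)"
proof -
  let ?F = "mapped_id br C" and ?G = "trunc_proj g n \<circ> mapped_id br C"
  let ?h = "\<lambda>p. remainder br C B g n p - (1 / fps_nth C 1) *\<^sub>R pre_remainder br C g n p"
  have lin_F: "linear ?F"
    by (simp add: mapped_id_def linear_conv_series)
  have lin_G: "linear ?G"
    by (intro linear_compose lin_F linear_trunc_proj)
  have lin_R: "linear (remainder br C B g n)" and lin_Q: "linear (pre_remainder br C g n)"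
    unfolding remainder_def[abs_def] pre_remainder_def[abs_def]
    by (intro linear_compose_sub linear_ident linear_conv_series lin_F lin_G)+
  have F0: "?F (base []) = 0"
    using assms(4)
    by (simp add: mapped_id_def inverse_series_pair_def conv_series_Nil[where X = aug, OF aug_Nil])
  have FG: "?F (base u) = ?G (base u)" if "g u \<le> n" for u
    using trunc_proj_graded[OF mapped_id_graded[OF assms(5,6)] that] by simp
  have G0: "?G (base []) = 0"
    using F0 by (simp add: linear_0[OF linear_trunc_proj])
  have "?h (base w) = 0" if w: "g w \<le> n + 1" for w
  proof -
    let ?d = "\<lambda>k. fps_nth B k *\<^sub>R (conv_power br ?F k (base w) - conv_power br ?G k (base w))"
    have "remainder br C B g n (base w) = conv_series br B ?F (base w) - conv_series br B ?G (base w)"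
      by (simp add: remainder_def conv_series_mapped_id[OF assms(1,3,4)])
    also have "\<dots> = (\<Sum>k\<le>Suc (length w). ?d k)"
      by (simp only: conv_series_base_ge[where X = ?F and N = "Suc (length w)", OF F0]
          conv_series_base_ge[where X = ?G and N = "Suc (length w)", OF G0] le_SucI order_refl
          sum_subtractf scaleR_diff_right)
    also have "\<dots> = (\<Sum>k\<in>{1}. ?d k)"
    proof (rule sum.mono_neutral_right)
      show "\<forall>k\<in>{..Suc (length w)} - {1}. ?d k = 0"
      proof
        fix k assume "k \<in> {..Suc (length w)} - {1}"
        then consider "k = 0" | "k \<ge> 2" by fastforce
        then show "?d k = 0"
          using conv_power_cong_next_grade[where X = ?F and Y = ?G, OF assms(5,6) FG F0 w]
          by cases simp_all
      qed
    qed auto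
    also have "\<dots> = (1 / fps_nth C 1) *\<^sub>R pre_remainder br C g n (base w)"
      using inverse_series_pair_coeff_1[OF assms(4)]
      by (simp add: pre_remainder_def convolution_unit_right lin_F lin_G)
    finally show ?thesis by simp
  qed
  moreover have "linear ?h"
    by (intro linear_compose_sub linear_compose_scale_right lin_R lin_Q)
  ultimately show ?thesis
    by (intro exI[of _ ?h]) simp
qed

end
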